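(* Let $m, n \geq 3$ be integers, and let $\gamma_{p}^{2}(f_{n\times m})$ denote the $2$-distance paired domination number of the flower graph $f_{n\times m}$. Then $$\gamma_{p}^{2}(f_{n \times m})= \begin{cases} 2\left\lceil \frac{nm-3n}{6}\right\rceil, & \text{if } m \equiv 0, 5 \pmod 6,\\[4pt] 2\left\lceil \frac{nm-n}{6}\right\rceil, & \text{if } m \equiv 1, 2 \pmod 6,\\[4pt] 2\left\lceil \frac{5nm-9n}{30}\right\rceil, & \text{if } m \equiv 3 \pmod 6,\\[4pt] 2\left\lceil \frac{2nm-5n}{12}\right\rceil, & \text{if } m \equiv 4 \pmod 6.\end{cases}$$
   Context: All graphs are finite and simple. For integers $m,n\ge 3$, the flower graph $f_{n\times m}$ is the graph with vertex set $\{u_i, v_{i,j} : 1\le i\le n,\ 1\le j\le m-2\}$ and edge set $E_1\cup E_2\cup E_3$, where $E_1=\{u_iu_{i+1} : 1\le i\le n\}$, $E_2=\{v_{i,j}v_{i,j+1} : 1\le i\le n,\ 1\le j\le m-3\}$, and $E_3=\{u_iv_{i,1},\ u_{i+1}v_{i,m-2} : 1\le i\le n\}$, with the index $i$ taken modulo $n$ (so $u_{n+1}=u_1$). It has $n(m-1)$ vertices and $nm$ edges. For a graph $G=(V,E)$ without isolated vertices and a positive integer $k$, a set $D\subseteq V$ is a $k$-distance paired dominating set if every vertex of $V\setminus D$ is within distance $k$ (in $G$) of at least one vertex of $D$ and the induced subgraph $\langle D\rangle$ has a perfect matching. The $k$-distance paired domination number $\gamma_p^k(G)$ is the minimum cardinality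 of a $k$-distance paired dominating set of $G$; here $k=2$. *)

theory Defs
  imports "Graph_Theory.Graph_Theory" "HOL-Library.Disjoint_Sets"
begin

text \<open>
  A finite simple graph is a \<^locale>\<open>pair_graph\<close> (finite, loop-free, symmetric), so that each
  undirected edge is represented by its two orientations.
\<close>

definition edges :: "('a, 'b) pre_digraph \<Rightarrow> 'a set set" where
  "edges G = (\<lambda>(u, v). {u, v}) ` arcs_ends G"

definition graph_dist :: "('a, 'b) pre_digraph \<Rightarrow> 'a \<Rightarrow> 'a \<Rightarrow> ereal" where
  "graph_dist G u v = wf_digraph.\<mu> G (\<lambda>_. 1) u v"

definition perfect_matching :: "('a, 'b) pre_digraph \<Rightarrow> 'a set set \<Rightarrow> bool" where
  "perfect_matching G M \<longleftrightarrow> M \<subseteq> edges G \<and> disjoint M \<and> \<Union>M = verts G"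

definition distance_paired_dominating ::
    "nat \<Rightarrow> ('a, 'b) pre_digraph \<Rightarrow> 'a set \<Rightarrow> bool" where
  "distance_paired_dominating k G D \<longleftrightarrow>
     D \<subseteq> verts G \<and>
     (\<forall>v \<in> verts G - D. \<exists>u \<in> D. graph_dist G v u \<le> ereal (real k)) \<and>
     (\<exists>M. perfect_matching (G \<restriction> D) M)"

text \<open>
  The minimum exists for every finite graph without isolated vertices and every positive \<open>k\<close>.
\<close>

definition distance_paired_domination_number :: "nat \<Rightarrow> ('a, 'b) pre_digraph \<Rightarrow> nat" where
  "distance_paired_domination_number k G =
     (LEAST c. \<exists>D. distance_paired_dominating k G D \<and> card D = c)"

datatype flower_vertex = UVert nat | VVert nat nat

definition next_index :: "nat \<Rightarrow> nat \<Rightarrow> nat" where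
  "next_index n i = (if i = n then 1 else i + 1)"

text \<open>The edge set of the flower graph, each edge listed in one orientation.\<close>

definition flower_arcs :: "nat \<Rightarrow> nat \<Rightarrow> flower_vertex rel" where
  "flower_arcs n m =
     {(UVert i, UVert (next_index n i)) | i. i \<in> {1..n}} \<union>
     {(VVert i j, VVert i (j + 1)) | i j. i \<in> {1..n} \<and> j \<in> {1..m - 3}} \<union>
     ({(UVert i, VVert i 1) | i. i \<in> {1..n}} \<union>
      {(UVert (next_index n i), VVert i (m - 2)) | i. i \<in> {1..n}})"

definition flower_graph :: "nat \<Rightarrow> nat \<Rightarrow> flower_vertex pair_pre_digraph" where
  "flower_graph n m =
     \<lparr> pverts = {UVert i | i. i \<in> {1..n}} \<union>
                {VVert i j | i j. i \<in> {1..n} \<and> j \<in> {1..m - 2}},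
       parcs = flower_arcs n m \<union> (flower_arcs n m)\<inverse> \<rparr>"

lemma flower_verts_image:
  "pverts (flower_graph n m) =
     UVert ` {1..n} \<union> (\<lambda>(i, j). VVert i j) ` ({1..n} \<times> {1..m - 2})"
  by (auto simp: flower_graph_def)

lemma pair_graph_flower_graph:
  assumes "n \<ge> 3" "m \<ge> 3"
  shows "pair_graph (flower_graph n m)"
proof -
  have wf: "u \<in> pverts (flower_graph n m) \<and> v \<in> pverts (flower_graph n m) \<and> u \<noteq> v"
    if "(u, v) \<in> flower_arcs n m" for u v
    using that assms by (auto simp: flower_arcs_def flower_graph_def next_index_def split: if_splits)
  have wf': "u \<in> pverts (flower_graph n m) \<and> v \<in> pverts (flower_graph n m) \<and> u \<noteq> v"
    if "(u, v) \<in> parcs (flower_graph n m)" for u v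
    using that wf[of u v] wf[of v u] by (auto simp: flower_graph_def)
  have fin: "finite (pverts (flower_graph n m))"
    unfolding flower_verts_image by auto
  have "parcs (flower_graph n m) \<subseteq> pverts (flower_graph n m) \<times> pverts (flower_graph n m)"
    using wf' by auto
  then have fin': "finite (parcs (flower_graph n m))"
    using fin by (meson finite_SigmaI finite_subset)
  show ?thesis
  proof unfold_locales
    show "symmetric (flower_graph n m)"
      by (auto simp: symmetric_def flower_graph_def intro!: symI)
  qed (use wf' fin fin' in auto)
qed

lemma card_flower_verts:
  assumes "n \<ge> 3" "m \<ge> 3"
  shows "card (verts (flower_graph n m)) = n * (m - 1)"
proof -
  have "card (pverts (flower_graph n m)) =
      card (UVert ` {1..n}) + card ((\<lambda>(i, j). VVert i j) ` ({1..n} \<times> {1..m - 2}))"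
    unfolding flower_verts_image by (intro card_Un_disjoint) auto
  also have "\<dots> = n + n * (m - 2)"
    by (simp add: card_image inj_on_def card_cartesian_product)
  also have "\<dots> = n * (m - 1)"
    using assms by (cases m) (auto simp: algebra_simps numeral_eq_Suc Suc_diff_le)
  finally show ?thesis by simp
qed

lemma card_flower_edges:
  assumes "n \<ge> 3" "m \<ge> 3"
  shows "card (edges (flower_graph n m)) = n * m"
proof -
  define A where "A = (\<lambda>i. {UVert i, UVert (next_index n i)}) ` {1..n}"
  define B where "B = (\<lambda>(i, j). {VVert i j, VVert i (j + 1)}) ` ({1..n} \<times> {1..m - 3})"
  define C where "C = (\<lambda>i. {UVert i, VVert i 1}) ` {1..n}"
  define D where "D = (\<lambda>i. {UVert (next_index n i), VVert i (m - 2)}) ` {1..n}"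
  note defs = A_def B_def C_def D_def
  have sym: "edges (flower_graph n m) = (\<lambda>(u, v). {u, v}) ` flower_arcs n m"
    by (force simp: edges_def flower_graph_def image_iff insert_commute)
  have eA: "{(UVert i, UVert (next_index n i)) | i. i \<in> {1..n}} =
      (\<lambda>i. (UVert i, UVert (next_index n i))) ` {1..n}"
    by blast
  have eB: "{(VVert i j, VVert i (j + 1)) | i j. i \<in> {1..n} \<and> j \<in> {1..m - 3}} =
      (\<lambda>(i, j). (VVert i j, VVert i (j + 1))) ` ({1..n} \<times> {1..m - 3})"
    by (auto simp: image_iff)
  have eC: "{(UVert i, VVert i 1) | i. i \<in> {1..n}} = (\<lambda>i. (UVert i, VVert i 1)) ` {1..n}"
    by blast
  have eD: "{(UVert (next_index n i), VVert i (m - 2)) | i. i \<in> {1..n}} =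
      (\<lambda>i. (UVert (next_index n i), VVert i (m - 2))) ` {1..n}"
    by blast
  have "edges (flower_graph n m) = A \<union> (B \<union> (C \<union> D))"
    unfolding sym flower_arcs_def defs eA eB eC eD image_Un image_image case_prod_beta
    by (simp only: fst_conv snd_conv Un_assoc)
  moreover have "card A = n"
  proof -
    have "inj_on (\<lambda>i. {UVert i, UVert (next_index n i)}) {1..n}"
    proof (rule inj_onI)
      fix i k
      assume "i \<in> {1..n}" "k \<in> {1..n}"
        and "{UVert i, UVert (next_index n i)} = {UVert k, UVert (next_index n k)}"
      then have "i = k \<or> i = next_index n k \<and> k = next_index n i"
        by (metis doubleton_eq_iff flower_vertex.inject(1))
      then show "i = k"
        using \<open>n \<ge> 3\<close> by (auto simp: next_index_def split: if_splits)
    qed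
    then show ?thesis
      by (simp add: A_def card_image)
  qed
  moreover have "card B = n * (m - 3)"
    unfolding B_def by (subst card_image) (auto simp: inj_on_def doubleton_eq_iff)
  moreover have "card C = n"
    by (auto simp: C_def card_image inj_on_def doubleton_eq_iff)
  moreover have "card D = n"
    by (auto simp: D_def card_image inj_on_def doubleton_eq_iff)
  moreover have "finite A" "finite B" "finite C" "finite D"
    by (auto simp: defs)
  moreover have "A \<inter> (B \<union> (C \<union> D)) = {}" "B \<inter> (C \<union> D) = {}"
    by (auto simp: defs doubleton_eq_iff)
  moreover have "C \<inter> D = {}"
  proof -
    have "next_index n i \<noteq> i" for i
      using \<open>n \<ge> 3\<close> by (simp add: next_index_def)
    then have "{UVert i, VVert i 1} \<noteq> {UVert (next_index n k), VVert k (m - 2)}" for i k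
      by (metis doubleton_eq_iff flower_vertex.distinct(1) flower_vertex.inject)
    then show ?thesis
      unfolding C_def D_def by blast
  qed
  ultimately have "card (edges (flower_graph n m)) = n + (n * (m - 3) + (n + n))"
    by (simp add: card_Un_disjoint)
  also have "\<dots> = n * (m - 3 + 3)"
    unfolding distrib_left by simp
  finally show ?thesis
    using assms by simp
qed

lemma flower_no_isolated:
  assumes "n \<ge> 3" "m \<ge> 3" "v \<in> verts (flower_graph n m)"
  shows "\<exists>w. (v, w) \<in> arcs_ends (flower_graph n m)"
proof (cases v)
  case (UVert i)
  then show ?thesis using assms
    by (auto simp: flower_graph_def flower_arcs_def)
next
  case (VVert i j)
  then have i: "i \<in> {1..n}" "j \<in> {1..m - 2}"
    using assms by (auto simp: flower_graph_def)
  show ?thesis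
  proof (cases "j = 1")
    case True
    then show ?thesis using VVert i by (auto simp: flower_graph_def flower_arcs_def)
  next
    case False
    then have "(VVert i (j - 1), VVert i (j - 1 + 1)) \<in> flower_arcs n m"
      using i unfolding flower_arcs_def by fastforce
    then show ?thesis using VVert False i by (auto simp: flower_graph_def)
  qed
qed

end

theory Submission
  imports Defs
begin

text \<open>
  Put \<open>L = m - 2\<close>, the number of inner vertices of a petal, and write \<open>L = 6 q + s\<close> with \<open>s < 6\<close> and
  \<open>k = 6 - s\<close>. The four formulas are one: the number is \<open>2 (n q + \<lceil>n / k\<rceil>)\<close>.

  Two adjacent vertices of a path dominate at most six consecutive vertices of it. A petal
  together with its two hubs is a path, with the hubs at positions \<open>0\<close> and \<open>L + 1\<close>, and a matched
  pair at positions \<open>p, p + 1\<close> dominates the positions from \<open>p - 2\<close> to \<open>p + 3\<close>. What the pairs of a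
  petal must cover depends on the two hubs. A hub of distance \<open>d\<close> from \<open>D\<close> that does not rely on
  the petal dominates the first \<open>2 - d\<close> inner vertices by itself, so that much less has to be
  covered; a hub that does rely on the petal, because it is matched into it or dominated from
  it, forces a pair so near to that end that its interval sticks out of the petal by \<open>3\<close>,
  \<open>2\<close> or \<open>1\<close> positions. With the signed quantities \<open>left_need\<close> and \<open>right_need\<close>, the pairs
  cover an interval of \<open>L + left_need + right_need\<close> integers (\<open>petal_count\<close>).

  Lower bound. As both needs are at least \<open>-2\<close>, every petal contains at least \<open>q\<close> pairs, and exactly
  \<open>q\<close> only if the needs sum to at most \<open>-s\<close>. Call pairs beyond \<open>q\<close> in a petal, and a pair formed by
  its two hubs, the surplus of the petal. A petal without surplus joins hubs whose distances to
  \<open>D\<close> sum to at most \<open>k - 2\<close>; moreover a hub between two such petals is outside \<open>D\<close> and can be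
  dominated only by way of a neighbouring hub. Around the cycle of hubs this is impossible
  for \<open>k\<close> consecutive petals (\<open>no_long_gap\<close>, \<open>surplus_window\<close>), so averaging over all windows of
  length \<open>k\<close> gives a total surplus of at least \<open>n / k\<close>.

  Upper bound. Cut the cycle of hubs into \<open>\<lceil>n / k\<rceil>\<close> groups of at most \<open>k\<close> consecutive hubs, spend
  one extra pair on the first two hubs of each group, and let the distances of the
  hubs to these pairs determine where the \<open>q\<close> pairs of each petal begin. Consecutive distances
  sum to at most \<open>k - 2\<close> (\<open>depth_sum\<close>), which is just what makes \<open>q\<close> pairs per petal suffice. Where
  a group is a single hub, that hub is matched into its petal instead.
\<close>

section \<open>Distance to a set of vertices\<close>

text \<open>The vertices with a walk of length at most \<open>t\<close> into \<open>D\<close>.\<close>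

primrec near :: "('a, 'b) pre_digraph \<Rightarrow> 'a set \<Rightarrow> nat \<Rightarrow> 'a set" where
  "near G D 0 = D"
| "near G D (Suc t) = near G D t \<union> {v. \<exists>w \<in> near G D t. (v, w) \<in> arcs_ends G}"

lemma near_mono: "s \<le> t \<Longrightarrow> near G D s \<subseteq> near G D t"
  by (induction t) (auto simp: le_Suc_eq)

lemma near_step: "w \<in> near G D t \<Longrightarrow> (v, w) \<in> arcs_ends G \<Longrightarrow> v \<in> near G D (Suc t)"
  by auto

lemma near_cases:
  assumes "v \<in> near G D (Suc t)"
  obtains "v \<in> D" | w where "(v, w) \<in> arcs_ends G" "w \<in> near G D t"
  using assms by (induction t) auto

lemma near_1: "v \<in> near G D 1 \<longleftrightarrow> v \<in> D \<or> (\<exists>w \<in> D. (v, w) \<in> arcs_ends G)"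
  by auto

declare near.simps(2) [simp del]

context wf_digraph
begin

lemma near_imp_awalk:
  assumes "D \<subseteq> verts G" "v \<in> near G D t"
  shows "\<exists>u \<in> D. \<exists>p. awalk v p u \<and> length p \<le> t"
  using assms(2)
proof (induction t arbitrary: v)
  case 0
  then show ?case
    using assms(1) by (intro bexI[of _ v] exI[of _ "[]"]) (auto simp: awalk_Nil_iff)
next
  case (Suc t)
  from Suc.prems consider "v \<in> near G D t" | w where "w \<in> near G D t" "(v, w) \<in> arcs_ends G"
    by (auto simp: near.simps)
  then show ?case
  proof cases
    case 1
    then show ?thesis using Suc.IH le_SucI by blast
  next
    case 2
    then obtain u p where "u \<in> D" and p: "awalk w p u" "length p \<le> t"
      using Suc.IH by blast
    from 2 obtain e where "e \<in> arcs G" "tail G e = v" "head G e = w"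
      by (auto simp: arcs_ends_conv)
    with p have "awalk v (e # p) u"
      by (auto simp: awalk_Cons_iff)
    with p \<open>u \<in> D\<close> show ?thesis
      by (intro bexI[of _ u] exI[of _ "e # p"]) auto
  qed
qed

lemma awalk_imp_near:
  assumes "awalk v p u" "u \<in> D" "length p \<le> t"
  shows "v \<in> near G D t"
  using assms
proof (induction p arbitrary: v t)
  case Nil
  then show ?case using near_mono[of 0 t G D] by (auto simp: awalk_Nil_iff)
next
  case (Cons e p)
  then obtain t' where t: "t = Suc t'" "length p \<le> t'" by (cases t) auto
  with Cons have "head G e \<in> near G D t'" "(v, head G e) \<in> arcs_ends G"
    by (auto simp: awalk_Cons_iff arcs_ends_conv)
  then show ?case using t near_step by fast
qed

text \<open>
  The distance is an infimum of real walk lengths. These are integers, so an infimum at most \<open>t\<close> is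
  witnessed by some walk of length below \<open>t + 1\<close>.
\<close>

lemma near_iff_graph_dist:
  assumes "D \<subseteq> verts G"
  shows "v \<in> near G D t \<longleftrightarrow> (\<exists>u \<in> D. graph_dist G v u \<le> ereal (real t))"
proof
  have cost: "awalk_cost (\<lambda>_. 1) p = real (length p)" for p
    by (induction p) auto
  {
    assume "v \<in> near G D t"
    then obtain u p where "u \<in> D" "awalk v p u" "length p \<le> t"
      using near_imp_awalk[OF assms] by blast
    moreover from this have "graph_dist G v u \<le> ereal (real (length p))"
      unfolding graph_dist_def using min_cost_le_walk_cost cost by metis
    ultimately show "\<exists>u \<in> D. graph_dist G v u \<le> ereal (real t)"
      by (intro bexI[of _ u]) (auto intro: order_trans)
  next
    assume "\<exists>u \<in> D. graph_dist G v u \<le> ereal (real t)"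
    then obtain u where u: "u \<in> D" "graph_dist G v u \<le> ereal (real t)" by blast
    then have "(INF p\<in>{p. awalk v p u}. ereal (real (length p))) < ereal (real (Suc t))"
      unfolding graph_dist_def \<mu>_def cost by (rule_tac le_less_trans) auto
    then obtain p where "awalk v p u" "length p \<le> t"
      by (auto simp: INF_less_iff)
    then show "v \<in> near G D t"
      using awalk_imp_near u by blast
  }
qed

end

lemma distance_paired_dominating_iff_near:
  assumes "wf_digraph G"
  shows "distance_paired_dominating t G D \<longleftrightarrow>
    D \<subseteq> verts G \<and> verts G \<subseteq> near G D t \<and> (\<exists>M. perfect_matching (G \<restriction> D) M)"
proof -
  interpret wf_digraph G by fact
  show ?thesis
  proof (cases "D \<subseteq> verts G")
    case True
    have "(\<forall>v \<in> verts G - D. v \<in> near G D t) \<longleftrightarrow> verts G \<subseteq> near G D t"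
      using near_mono[of 0 t G D] by auto
    then show ?thesis
      unfolding distance_paired_dominating_def near_iff_graph_dist[OF True] by blast
  qed (auto simp: distance_paired_dominating_def)
qed

section \<open>Windows on a cycle\<close>

text \<open>
  Summing over the \<open>k\<close> shifts of a window counts each value of \<open>ev\<close> exactly \<open>k\<close> times, since the
  iterates of \<open>f\<close> permute \<open>A\<close>; and each of the \<open>card A\<close> windows contributes at least one. Windows may
  wrap around the cycle more than once.
\<close>

lemma sum_ge_of_windows:
  fixes ev :: "'a \<Rightarrow> nat"
  assumes "finite A" "bij_betw f A A"
    and window: "\<And>i. i \<in> A \<Longrightarrow> \<exists>j<k. 0 < ev ((f ^^ j) i)"
  shows "card A \<le> k * sum ev A"
proof -
  have "card A = (\<Sum>i\<in>A. 1)" by simp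
  also have "\<dots> \<le> (\<Sum>i\<in>A. \<Sum>j<k. ev ((f ^^ j) i))"
  proof (rule sum_mono)
    fix i assume "i \<in> A"
    then obtain j where "j < k" "0 < ev ((f ^^ j) i)" using window by blast
    then show "1 \<le> (\<Sum>j<k. ev ((f ^^ j) i))"
      using member_le_sum[of j "{..<k}" "\<lambda>j. ev ((f ^^ j) i)"] by auto
  qed
  also have "\<dots> = (\<Sum>j<k. \<Sum>i\<in>A. ev ((f ^^ j) i))"
    by (rule sum.swap)
  also have "\<dots> = (\<Sum>j<k. sum ev A)"
    by (intro sum.cong refl sum.reindex_bij_betw[OF bij_betw_funpow[OF assms(2)]])
  finally show ?thesis by simp
qed

text \<open>
  Read \<open>d j\<close> as the distance to \<open>D\<close> of the \<open>j\<close>-th hub in a run of \<open>k\<close> petals without surplus. The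
  inner hubs lie outside \<open>D\<close>, so distance \<open>1\<close> occurs only next to the ends of the run and the
  remaining inner hubs have distance \<open>2\<close>. For \<open>k \<le> 5\<close> two consecutive distances are then too large, and for
  \<open>k = 6\<close> the middle hub has no neighbour that could dominate it.
\<close>

lemma no_long_gap:
  fixes d :: "nat \<Rightarrow> nat"
  assumes k: "1 \<le> k" "k \<le> 6"
    and sums: "\<And>j. j < k \<Longrightarrow> d j + d (Suc j) + 2 \<le> k"
    and range: "\<And>j. 0 < j \<Longrightarrow> j < k \<Longrightarrow> d j \<in> {1, 2}"
    and one: "\<And>j. 0 < j \<Longrightarrow> j < k \<Longrightarrow> d j = 1 \<Longrightarrow> d (j - 1) = 0 \<or> d (Suc j) = 0"
    and two: "\<And>j. 0 < j \<Longrightarrow> j < k \<Longrightarrow> d j = 2 \<Longrightarrow> d (j - 1) \<le> 1 \<or> d (Suc j) \<le> 1"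
  shows False
proof -
  have ends: "j = 1 \<or> Suc j = k" if "0 < j" "j < k" "d j = 1" for j
    using one[OF that] range[of "j - 1"] range[of "Suc j"] that by force
  have 2: "d j = 2" if "1 < j" "Suc j < k" for j
    using ends[of j] range[of j] that by fastforce
  consider "k = 1" | "k = 2" | "k = 3" | "k = 4" | "k = 5" | "k = 6"
    using k by linarith
  then show False
  proof cases
    case 1
    then show ?thesis using sums[of 0] by auto
  next
    case 2
    then show ?thesis using sums[of 0] range[of 1] by auto
  next
    case 3
    then show ?thesis using sums[of 1] range[of 1] range[of 2] by (auto simp: numeral_2_eq_2)
  next
    case 4
    then show ?thesis
      using sums[of 1] range[of 1] 2[of 2] by (auto simp: numeral_2_eq_2)
  next
    case 5
    then show ?thesis using sums[of 2] 2[of 2] 2[of 3] by (auto simp: eval_nat_numeral)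
  next
    case 6
    then show ?thesis
      using two[of 3] 2[of 2] 2[of 3] 2[of 4] by (auto simp: eval_nat_numeral)
  qed
qed


section \<open>Coordinates on the flower graph\<close>

lemma edges_induce_subgraph: "edges (G \<restriction> D) = {e \<in> edges G. e \<subseteq> D}"
proof (intro set_eqI iffI)
  fix e assume "e \<in> edges (G \<restriction> D)"
  then show "e \<in> {e \<in> edges G. e \<subseteq> D}"
    by (auto simp: edges_def arcs_ends_conv)
next
  fix e assume "e \<in> {e \<in> edges G. e \<subseteq> D}"
  then obtain a where "a \<in> arcs G" "e = {tail G a, head G a}" "e \<subseteq> D"
    by (auto simp: edges_def arcs_ends_conv)
  then show "e \<in> edges (G \<restriction> D)"
    by (auto simp: edges_def arcs_ends_conv image_iff intro!: bexI[of _ a])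
qed

text \<open>
  Petal \<open>i\<close> is the path \<open>pos i 0, \<dots>, pos i (L + 1)\<close> from hub \<open>u\<^sub>i\<close> to the next hub. Its path
  edges carry the labels \<open>(i, 0), \<dots>, (i, L)\<close>; the label \<open>(i, L + 1)\<close> closes the path to an
  \<open>m\<close>-cycle by the edge between the two hubs. Every edge of the graph has exactly one such label.
\<close>

locale flower =
  fixes n m :: nat
  assumes n3: "3 \<le> n" and m3: "3 \<le> m"
begin

abbreviation F :: "(flower_vertex, flower_vertex \<times> flower_vertex) pre_digraph" where
  "F \<equiv> with_proj (flower_graph n m)"

abbreviation succ :: "nat \<Rightarrow> nat" where
  "succ \<equiv> next_index n"

definition L :: nat where
  "L = m - 2"

definition pos :: "nat \<Rightarrow> nat \<Rightarrow> flower_vertex" where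
  "pos i p = (if p = 0 then UVert i else if p \<le> L then VVert i p else UVert (succ i))"

definition edge :: "nat \<Rightarrow> nat \<Rightarrow> flower_vertex set" where
  "edge i p = {pos i p, pos i (if p \<le> L then Suc p else 0)}"

lemma wf_F: "wf_digraph F"
proof -
  interpret pair_graph "flower_graph n m"
    using pair_graph_flower_graph[OF n3 m3] .
  show ?thesis
    by unfold_locales
qed

lemma no_loop: "(u, u) \<notin> arcs_ends F"
proof -
  interpret pair_graph "flower_graph n m"
    using pair_graph_flower_graph[OF n3 m3] .
  show ?thesis
    using no_loops[of "(u, u)"] by auto
qed

lemma L_pos: "1 \<le> L"
  using m3 by (simp add: L_def)

lemma pos_0 [simp]: "pos i 0 = UVert i"
  and pos_Suc_L [simp]: "pos i (Suc L) = UVert (succ i)"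
  by (auto simp: pos_def)

lemma pos_inner: "1 \<le> p \<Longrightarrow> p \<le> L \<Longrightarrow> pos i p = VVert i p"
  by (auto simp: pos_def)

lemma edge_path: "p \<le> L \<Longrightarrow> edge i p = {pos i p, pos i (Suc p)}"
  and edge_hub: "edge i (Suc L) = {UVert i, UVert (succ i)}"
  by (auto simp: edge_def)

lemma succ_range: "i \<in> {1..n} \<Longrightarrow> succ i \<in> {1..n}"
  using n3 by (auto simp: next_index_def)

lemma succ_inj: "inj_on succ {1..n}"
  using n3 by (auto simp: next_index_def inj_on_def split: if_splits)

lemma succ_bij: "bij_betw succ {1..n} {1..n}"
proof -
  have "succ ` {1..n} \<subseteq> {1..n}"
    using succ_range by blast
  then have "succ ` {1..n} = {1..n}"
    by (intro endo_inj_surj succ_inj) auto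
  then show ?thesis
    using succ_inj by (auto simp: bij_betw_def)
qed

lemma pos_in_verts: "i \<in> {1..n} \<Longrightarrow> pos i p \<in> verts F"
  using succ_range[of i] by (auto simp: flower_graph_def pos_def L_def[symmetric])

lemma verts_cases:
  assumes "v \<in> verts F"
  obtains i p where "i \<in> {1..n}" "p \<le> L" "v = pos i p"
proof (cases v)
  case (UVert i)
  then show thesis
    using assms that[of i 0] by (auto simp: flower_graph_def)
next
  case (VVert i p)
  then show thesis
    using assms that[of i p] by (auto simp: flower_graph_def pos_def L_def)
qed

lemma arc_imp_edge:
  assumes "(u, v) \<in> flower_arcs n m"
  shows "\<exists>i \<in> {1..n}. \<exists>p \<le> Suc L. {u, v} = edge i p"
proof -
  from assms consider
      i where "i \<in> {1..n}" "u = UVert i" "v = UVert (succ i)"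
    | i p where "i \<in> {1..n}" "p \<in> {1..m - 3}" "u = VVert i p" "v = VVert i (p + 1)"
    | i where "i \<in> {1..n}" "u = UVert i" "v = VVert i 1"
    | i where "i \<in> {1..n}" "u = UVert (succ i)" "v = VVert i (m - 2)"
    unfolding flower_arcs_def by blast
  then show ?thesis
  proof cases
    case 1
    then show ?thesis by (intro bexI[of _ i] exI[of _ "Suc L"]) (auto simp: edge_hub)
  next
    case 2
    then have "p \<le> L" "Suc p \<le> L" by (auto simp: L_def)
    with 2 show ?thesis
      by (intro bexI[of _ i] exI[of _ p]) (auto simp: edge_path pos_inner)
  next
    case 3
    then show ?thesis
      using L_pos by (intro bexI[of _ i] exI[of _ 0]) (auto simp: edge_path pos_inner)
  next
    case 4
    then show ?thesis
      using L_pos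
      by (intro bexI[of _ i] exI[of _ L]) (auto simp: edge_path pos_inner L_def[symmetric])
  qed
qed

lemma edge_imp_arc:
  assumes "i \<in> {1..n}" "p \<le> Suc L"
  obtains u v where "(u, v) \<in> flower_arcs n m" "edge i p = {u, v}"
proof -
  consider "p = 0" | "1 \<le> p" "p < L" | "p = L" | "p = Suc L"
    using assms by linarith
  then show thesis
  proof cases
    case 1
    then show thesis
      using that[of "UVert i" "VVert i 1"] assms L_pos
      by (auto simp: flower_arcs_def edge_path pos_inner)
  next
    case 2
    then show thesis
      using that[of "VVert i p" "VVert i (p + 1)"] assms
      by (auto simp: flower_arcs_def edge_path pos_inner L_def)
  next
    case 3
    then show thesis
      using that[of "UVert (succ i)" "VVert i (m - 2)"] assms L_pos
      by (auto simp: flower_arcs_def edge_path pos_inner L_def[symmetric])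
  next
    case 4
    then show thesis
      using that[of "UVert i" "UVert (succ i)"] assms by (auto simp: flower_arcs_def edge_hub)
  qed
qed

lemma arc_iff: "(u, v) \<in> arcs_ends F \<longleftrightarrow> (\<exists>i \<in> {1..n}. \<exists>p \<le> Suc L. {u, v} = edge i p)"
proof
  assume "(u, v) \<in> arcs_ends F"
  then have "(u, v) \<in> flower_arcs n m \<or> (v, u) \<in> flower_arcs n m"
    by (auto simp: flower_graph_def)
  then show "\<exists>i \<in> {1..n}. \<exists>p \<le> Suc L. {u, v} = edge i p"
    using arc_imp_edge[of u v] arc_imp_edge[of v u] insert_commute[of u v "{}"] by (elim disjE) simp_all
next
  assume "\<exists>i \<in> {1..n}. \<exists>p \<le> Suc L. {u, v} = edge i p"
  then obtain i p where "i \<in> {1..n}" "p \<le> Suc L" "{u, v} = edge i p"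
    by blast
  moreover from this(1,2) obtain a b where "(a, b) \<in> flower_arcs n m" "edge i p = {a, b}"
    by (rule edge_imp_arc)
  ultimately have "(a, b) \<in> flower_arcs n m" "{u, v} = {a, b}"
    by simp_all
  then show "(u, v) \<in> arcs_ends F"
    by (auto simp: flower_graph_def doubleton_eq_iff)
qed

lemma edges_eq: "edges F = (\<lambda>(i, p). edge i p) ` ({1..n} \<times> {..Suc L})"
proof (intro set_eqI iffI)
  fix e assume "e \<in> edges F"
  then obtain u v where "(u, v) \<in> arcs_ends F" "e = {u, v}"
    by (auto simp: edges_def)
  then show "e \<in> (\<lambda>(i, p). edge i p) ` ({1..n} \<times> {..Suc L})"
    unfolding arc_iff by auto
next
  fix e assume "e \<in> (\<lambda>(i, p). edge i p) ` ({1..n} \<times> {..Suc L})"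
  then obtain i p where "i \<in> {1..n}" "p \<le> Suc L" and e: "e = edge i p"
    by auto
  then have "\<exists>u v. (u, v) \<in> arcs_ends F \<and> e = {u, v}"
    unfolding arc_iff edge_def by blast
  then show "e \<in> edges F"
    by (force simp: edges_def)
qed

text \<open>There are as many labels as edges, \<open>n m\<close> in number, so a surjection is a bijection.\<close>

lemma edge_inj: "inj_on (\<lambda>(i, p). edge i p) ({1..n} \<times> {..Suc L})"
proof (rule eq_card_imp_inj_on)
  have "Suc (Suc L) = m"
    using m3 by (simp add: L_def)
  then have "card ({1..n} \<times> {..Suc L}) = n * m"
    unfolding card_cartesian_product by simp
  then show "card ((\<lambda>(i, p). edge i p) ` ({1..n} \<times> {..Suc L})) = card ({1..n} \<times> {..Suc L})"
    using card_flower_edges[OF n3 m3] by (simp only: edges_eq)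
qed auto

lemma arc_sym: "(u, v) \<in> arcs_ends F \<Longrightarrow> (v, u) \<in> arcs_ends F"
  by (auto simp: flower_graph_def)

lemma path_arc: "i \<in> {1..n} \<Longrightarrow> p \<le> L \<Longrightarrow> (pos i p, pos i (Suc p)) \<in> arcs_ends F"
  unfolding arc_iff by (intro bexI[of _ i] exI[of _ p]) (auto simp: edge_path)

lemma hub_arc: "i \<in> {1..n} \<Longrightarrow> (UVert i, UVert (succ i)) \<in> arcs_ends F"
  unfolding arc_iff by (intro bexI[of _ i] exI[of _ "Suc L"]) (auto simp: edge_hub)

text \<open>
  The next four lemmas list the edges and the neighbours at a vertex: petals meet the rest of the
  graph in their hubs only, and a hub has two neighbouring hubs and one neighbour inside each of
  two petals.
\<close>

lemma edge_at_inner: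
  assumes "j \<in> {1..n}" "r \<le> Suc L" "pos i p \<in> edge j r" "1 \<le> p" "p \<le> L"
  shows "j = i \<and> r \<le> L \<and> (r = p \<or> Suc r = p)"
  using assms unfolding edge_def pos_inner[OF assms(4,5)]
  by (auto simp: pos_def split: if_splits)

lemma edge_at_hub:
  assumes "i \<in> {1..n}" "j \<in> {1..n}" "r \<le> Suc L" "UVert (succ i) \<in> edge j r"
  shows "(j = succ i \<and> (r = 0 \<or> r = Suc L)) \<or> (j = i \<and> (r = L \<or> r = Suc L))"
  using assms inj_onD[OF succ_inj, of i j] L_pos unfolding edge_def
  by (auto simp: pos_def split: if_splits)

lemma inner_nbr:
  assumes "(pos i p, w) \<in> arcs_ends F" "1 \<le> p" "p \<le> L"
  shows "w = pos i (p - 1) \<or> w = pos i (Suc p)"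
proof -
  from assms(1) obtain j r where jr: "j \<in> {1..n}" "r \<le> Suc L" "{pos i p, w} = edge j r"
    unfolding arc_iff by blast
  have "j = i" "r \<le> L" "r = p \<or> Suc r = p"
    using edge_at_inner[OF jr(1,2) _ assms(2,3)] jr(3) by auto
  then show ?thesis
    using jr(3) assms(2) by (auto simp: edge_path doubleton_eq_iff)
qed

lemma hub_nbr:
  assumes "(UVert (succ i), w) \<in> arcs_ends F" "i \<in> {1..n}"
  shows "w \<in> {pos (succ i) 1, pos i L, UVert i, UVert (succ (succ i))}"
proof -
  from assms(1) obtain j r where jr: "j \<in> {1..n}" "r \<le> Suc L" "{UVert (succ i), w} = edge j r"
    unfolding arc_iff by blast
  have "(j = succ i \<and> (r = 0 \<or> r = Suc L)) \<or> (j = i \<and> (r = L \<or> r = Suc L))"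
    using edge_at_hub[OF assms(2) jr(1,2)] jr(3) by auto
  then show ?thesis
    using jr(3) by (auto simp: edge_path edge_hub doubleton_eq_iff)
qed

end

section \<open>The interval covered by the pairs of a petal\<close>

locale paired_dominated_flower = flower +
  fixes D :: "flower_vertex set" and M :: "flower_vertex set set"
  assumes dominated: "verts F \<subseteq> near F D 2"
    and M_edges: "M \<subseteq> edges F" and M_disjoint: "disjoint M" and M_covers: "\<Union>M = D"
begin

text \<open>
  Let \<open>u\<close> be an end of a petal and \<open>v\<close>, \<open>w\<close> the next two vertices of the petal. A positive value
  is a number of positions beyond the inner vertices, at this end, that lie in the interval of a
  pair of the petal: a pair that contains \<open>u\<close>, or comes within distance one or two of it. A value
  \<open>-j\<close> says that the first \<open>j\<close> inner vertices are dominated by way of \<open>u\<close>, without help of the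
  petal. The order of the tests matters: a neighbour of \<open>u\<close> in \<open>D\<close> other than \<open>v\<close> takes
  precedence over \<open>w\<close>. This covers the case \<open>L = 1\<close> too, in which \<open>w\<close> is the opposite hub.
\<close>

definition need :: "flower_vertex \<Rightarrow> flower_vertex \<Rightarrow> flower_vertex \<Rightarrow> int" where
  "need u v w =
    (if u \<in> D then (if {u, v} \<in> M then 3 else -2)
     else if v \<in> D then 2
     else if u \<in> near F D 1 then -1
     else if w \<in> D then 1
     else 0)"

definition left_need :: "nat \<Rightarrow> int" where
  "left_need i = need (UVert i) (pos i 1) (pos i 2)"

definition right_need :: "nat \<Rightarrow> int" where
  "right_need i = need (UVert (succ i)) (pos i L) (pos i (L - 1))"

definition hub_dist :: "nat \<Rightarrow> nat" where
  "hub_dist i = (if UVert i \<in> D then 0 else if UVert i \<in> near F D 1 then 1 else 2)"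

lemma hub_dist_eq_0: "hub_dist i = 0 \<longleftrightarrow> UVert i \<in> D"
  and hub_dist_le_1: "hub_dist i \<le> 1 \<longleftrightarrow> UVert i \<in> near F D 1"
  and hub_dist_le_2: "hub_dist i \<le> 2"
  by (simp_all add: hub_dist_def near_1[unfolded One_nat_def])

definition petal_edges :: "nat \<Rightarrow> nat set" where
  "petal_edges i = {p. p \<le> L \<and> edge i p \<in> M}"

lemma finite_petal_edges: "finite (petal_edges i)"
  by (auto simp: petal_edges_def)

lemma petal_edges_in_D: "p \<in> petal_edges i \<Longrightarrow> pos i p \<in> D \<and> pos i (Suc p) \<in> D"
proof -
  assume "p \<in> petal_edges i"
  then have "p \<le> L" "edge i p \<subseteq> D"
    using M_covers by (auto simp: petal_edges_def)
  then show ?thesis by (simp add: edge_path)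
qed

lemma matched:
  assumes "v \<in> D"
  obtains j r where "j \<in> {1..n}" "r \<le> Suc L" "v \<in> edge j r" "edge j r \<in> M"
proof -
  obtain e where e: "e \<in> M" "v \<in> e"
    using assms M_covers by auto
  then have "e \<in> (\<lambda>(i, p). edge i p) ` ({1..n} \<times> {..Suc L})"
    using M_edges edges_eq by auto
  then obtain j r where "j \<in> {1..n}" "r \<le> Suc L" "e = edge j r"
    by auto
  with e show thesis using that by simp
qed

lemma inner_matched:
  assumes "pos i p \<in> D" "1 \<le> p" "p \<le> L"
  obtains r where "r \<in> petal_edges i" "p = r \<or> p = Suc r"
proof -
  obtain j r where "j \<in> {1..n}" "r \<le> Suc L" "pos i p \<in> edge j r" "edge j r \<in> M"
    using matched[OF assms(1)] .
  with edge_at_inner[OF this(1,2,3) assms(2,3)] show thesis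
    using that[of r] by (auto simp: petal_edges_def)
qed

text \<open>
  A path of length at most two from an inner vertex into \<open>D\<close> either stays in the petal or leaves it
  through a hub; in the latter case it starts next to that hub, and the hub is dominated at
  distance at most one.
\<close>

lemma petal_covered:
  assumes i: "i \<in> {1..n}" and p: "1 \<le> p" "p \<le> L"
  shows "(\<exists>p' \<le> Suc L. pos i p' \<in> D \<and> p' \<le> p + 2 \<and> p \<le> p' + 2)
    \<or> p = 1 \<and> UVert i \<in> near F D 1 \<or> p = L \<and> UVert (succ i) \<in> near F D 1"
    (is "(\<exists>p'. ?close p') \<or> _")
proof -
  have step: "\<exists>p' \<le> Suc L. pos i p' \<in> D \<and> p' \<le> p + 1 \<and> p \<le> p' + 1"
    if near1: "pos i p \<in> near F D 1" and p: "1 \<le> p" "p \<le> L" for p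
  proof -
    from near1 consider "pos i p \<in> D" | w where "(pos i p, w) \<in> arcs_ends F" "w \<in> D"
      unfolding near_1 by blast
    then show ?thesis
    proof cases
      case 1
      then show ?thesis using p by (intro exI[of _ p]) simp
    next
      case 2
      then consider "pos i (p - 1) \<in> D" | "pos i (Suc p) \<in> D"
        using inner_nbr[OF 2(1) p] by blast
      then show ?thesis
      proof cases
        case 1
        then show ?thesis using p by (intro exI[of _ "p - 1"]) (simp, linarith)
      next
        case 2
        then show ?thesis using p by (intro exI[of _ "Suc p"]) simp
      qed
    qed
  qed
  have "pos i p \<in> near F D (Suc 1)"
    using dominated pos_in_verts[OF i] by (metis Suc_1 subsetD)
  then show ?thesis
  proof (cases rule: near_cases)
    case 1
    then show ?thesis using p by (intro disjI1 exI[of _ p]) simp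
  next
    case (2 w)
    consider "w = UVert i" "p = 1" | "w = UVert (succ i)" "p = L"
      | "w = pos i (p - 1)" "1 < p" | "w = pos i (Suc p)" "p < L"
      using inner_nbr[OF 2(1) p] p pos_Suc_L[of i] by (cases "p = 1"; cases "p = L") (auto simp del: pos_Suc_L)
    then show ?thesis
    proof cases
      case 3
      moreover from this have "1 \<le> p - 1" "p - 1 \<le> L" using p by linarith+
      ultimately obtain p' where "p' \<le> Suc L" "pos i p' \<in> D" "p' \<le> p - 1 + 1" "p - 1 \<le> p' + 1"
        using step[of "p - 1"] 2 by blast
      moreover from this have "p' \<le> p + 2" "p \<le> p' + 2" by linarith+
      ultimately show ?thesis by blast
    next
      case 4
      then obtain p' where "p' \<le> Suc L" "pos i p' \<in> D" "p' \<le> Suc p + 1" "Suc p \<le> p' + 1"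
        using step[of "Suc p"] 2 p by auto
      moreover from this have "p' \<le> p + 2" "p \<le> p' + 2" by linarith+
      ultimately show ?thesis by blast
    qed (use 2 in simp_all)
  qed
qed

text \<open>
  Every integer in an interval of length \<open>L + left_need i + right_need i\<close> lies within one of the
  intervals \<open>{r - 2..r + 3}\<close> of six integers, with \<open>r\<close> ranging over the matched path edges of the petal.
\<close>

lemma petal_count:
  assumes i: "i \<in> {1..n}"
  shows "int L + left_need i + right_need i \<le> 6 * int (card (petal_edges i))"
proof -
  have edge0: "edge i 0 = {UVert i, pos i 1}" and edgeL: "edge i L = {UVert (succ i), pos i L}"
    by (auto simp: edge_path)
  have cover: "\<exists>r \<in> petal_edges i. int r - 2 \<le> z \<and> z \<le> int r + 3"
    if z: "1 - left_need i \<le> z" "z \<le> int L + right_need i" for z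
  proof -
    \<comment> \<open>A hub in \<open>D\<close> that is matched elsewhere has need \<open>-2\<close>, so no position near it is asked for.\<close>
    have left: "\<exists>r \<in> petal_edges i. int r - 2 \<le> z \<and> z \<le> int r + 3"
      if "UVert i \<in> D" "z \<le> 2"
    proof -
      have "edge i 0 \<in> M"
        using that z unfolding left_need_def need_def edge0 by (auto split: if_splits)
      then have "0 \<in> petal_edges i" by (auto simp: petal_edges_def)
      then show ?thesis
        using that z unfolding left_need_def need_def
        by (intro bexI[of _ 0]) (auto split: if_splits)
    qed
    have right: "\<exists>r \<in> petal_edges i. int r - 2 \<le> z \<and> z \<le> int r + 3"
      if "UVert (succ i) \<in> D" "int L - 1 \<le> z"
    proof -
      have "edge i L \<in> M"
        using that z unfolding right_need_def need_def edgeL by (auto split: if_splits)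
      then have "L \<in> petal_edges i" by (auto simp: petal_edges_def)
      then show ?thesis
        using that z unfolding right_need_def need_def
        by (intro bexI[of _ L]) (auto split: if_splits)
    qed
    have inner: "\<exists>r \<in> petal_edges i. int r - 2 \<le> z \<and> z \<le> int r + 3"
      if p: "pos i p \<in> D" "1 \<le> p" "p \<le> L" "int p - 2 \<le> z" "z \<le> int p + 2" for p
    proof -
      obtain r where "r \<in> petal_edges i" "p = r \<or> p = Suc r"
        using inner_matched[OF p(1-3)] .
      then show ?thesis
        using p(4,5) by (intro bexI[of _ r]) auto
    qed
    consider "z \<le> 0" | "int L < z" | "1 \<le> z" "z \<le> int L" by linarith
    then show ?thesis
    proof cases
      case 1
      then have "1 \<le> left_need i" using z by simp
      then consider "UVert i \<in> D"
        | "UVert i \<notin> D" "pos i 1 \<in> D" "left_need i = 2"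
        | "UVert i \<notin> near F D 1" "pos i 1 \<notin> D" "pos i 2 \<in> D" "left_need i = 1"
        unfolding left_need_def need_def by (auto split: if_splits)
      then show ?thesis
      proof cases
        case 1
        then show ?thesis using left \<open>z \<le> 0\<close> by simp
      next
        case 2
        then obtain r where r: "r \<in> petal_edges i" "1 = r \<or> 1 = Suc r"
          using inner_matched[of i 1] L_pos by auto
        with petal_edges_in_D[OF r(1)] 2 have "r = 1" by auto
        then show ?thesis using r z 2 \<open>z \<le> 0\<close> by (intro bexI[of _ r]) auto
      next
        case 3
        \<comment> \<open>Otherwise \<open>pos i 2\<close> would be the next hub, a neighbour of \<open>u\<^sub>i\<close> in \<open>D\<close>.\<close>
        have "2 \<le> L"
        proof (rule ccontr)
          assume "\<not> 2 \<le> L"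
          then have "pos i 2 = UVert (succ i)" using L_pos by (auto simp: pos_def)
          then show False using 3 hub_arc[OF i] near_1 by metis
        qed
        then obtain r where r: "r \<in> petal_edges i" "2 = r \<or> 2 = Suc r"
          using inner_matched[of i 2] 3 by auto
        with petal_edges_in_D[OF r(1)] 3 have "r = 2" by auto
        then show ?thesis using r z 3 \<open>z \<le> 0\<close> by (intro bexI[of _ r]) auto
      qed
    next
      case 2
      then have "1 \<le> right_need i" using z by simp
      then consider "UVert (succ i) \<in> D"
        | "UVert (succ i) \<notin> D" "pos i L \<in> D" "right_need i = 2"
        | "UVert (succ i) \<notin> near F D 1" "pos i L \<notin> D" "pos i (L - 1) \<in> D" "right_need i = 1"
        unfolding right_need_def need_def by (auto split: if_splits)
      then show ?thesis
      proof cases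
        case 1
        then show ?thesis using right \<open>int L < z\<close> by simp
      next
        case 2
        then obtain r where r: "r \<in> petal_edges i" "L = r \<or> L = Suc r"
          using inner_matched[of i L] L_pos by auto
        with petal_edges_in_D[OF r(1)] 2 have "L = Suc r" by auto
        then show ?thesis using r z 2 \<open>int L < z\<close> by (intro bexI[of _ r]) auto
      next
        case 3
        have "2 \<le> L"
        proof (rule ccontr)
          assume "\<not> 2 \<le> L"
          then have "pos i (L - 1) = UVert i" using L_pos by (auto simp: pos_def)
          then show False using 3 arc_sym[OF hub_arc[OF i]] near_1 by metis
        qed
        then have "1 \<le> L - 1" "L - 1 \<le> L" by linarith+
        with 3 obtain r where r: "r \<in> petal_edges i" "L - 1 = r \<or> L - 1 = Suc r"
          by (metis inner_matched)
        with petal_edges_in_D[OF r(1)] 3 \<open>2 \<le> L\<close> have "L = Suc (Suc r)"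
          by (metis Suc_diff_le diff_Suc_1 L_pos One_nat_def)
        then show ?thesis using r z 3 \<open>int L < z\<close> by (intro bexI[of _ r]) auto
      qed
    next
      case 3
      define p where "p = nat z"
      then have p: "z = int p" "1 \<le> p" "p \<le> L" using 3 by auto
      from petal_covered[OF i p(2,3)] consider
          p' where "p' \<le> Suc L" "pos i p' \<in> D" "p' \<le> p + 2" "p \<le> p' + 2"
        | "p = 1" "UVert i \<in> near F D 1"
        | "p = L" "UVert (succ i) \<in> near F D 1"
        by blast
      then show ?thesis
      proof cases
        case 1
        consider "p' = 0" | "p' = Suc L" | "1 \<le> p'" "p' \<le> L"
          using 1 by linarith
        then show ?thesis
        proof cases
          case 1
          then show ?thesis using left \<open>pos i p' \<in> D\<close> \<open>p \<le> p' + 2\<close> p by simp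
        next
          case 2
          then show ?thesis using right \<open>pos i p' \<in> D\<close> \<open>p' \<le> p + 2\<close> p by simp
        next
          case 3
          then show ?thesis using inner[of p'] 1 p by simp
        qed
      next
        case 2
        then show ?thesis
          using left inner[of 1] z p L_pos
          by (cases "UVert i \<in> D"; cases "pos i 1 \<in> D") (auto simp: left_need_def need_def)
      next
        case 3
        then show ?thesis
          using right inner[of L] z p L_pos
          by (cases "UVert (succ i) \<in> D"; cases "pos i L \<in> D") (auto simp: right_need_def need_def)
      qed
    qed
  qed
  have "{1 - left_need i..int L + right_need i} \<subseteq> (\<Union>r\<in>petal_edges i. {int r - 2..int r + 3})"
    using cover by fastforce
  then have "card {1 - left_need i..int L + right_need i}
      \<le> card (\<Union>r\<in>petal_edges i. {int r - 2..int r + 3})"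
    by (intro card_mono) (auto simp: finite_petal_edges)
  also have "\<dots> \<le> (\<Sum>r\<in>petal_edges i. card {int r - 2..int r + 3})"
    by (rule card_UN_le) (rule finite_petal_edges)
  also have "\<dots> = 6 * card (petal_edges i)" by simp
  finally show ?thesis by simp
qed

section \<open>The lower bound\<close>

lemma left_need_ge: "int (hub_dist i) - 2 \<le> left_need i"
  and right_need_ge: "int (hub_dist (succ i)) - 2 \<le> right_need i"
  by (auto simp: left_need_def right_need_def need_def hub_dist_def near_1)

definition surplus :: "nat \<Rightarrow> nat" where
  "surplus i = card (petal_edges i) - L div 6 + (if edge i (Suc L) \<in> M then 1 else 0)"

lemma petal_edges_ge:
  assumes "i \<in> {1..n}"
  shows "L div 6 \<le> card (petal_edges i)"
  using petal_count[OF assms] left_need_ge[of i] right_need_ge[of i] by linarith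

lemma no_surplus:
  assumes "i \<in> {1..n}" "surplus i = 0"
  shows "left_need i + right_need i + int (L mod 6) \<le> 0" and "edge i (Suc L) \<notin> M"
proof -
  have "card (petal_edges i) \<le> L div 6" "edge i (Suc L) \<notin> M"
    using assms(2) by (auto simp: surplus_def split: if_splits)
  moreover have "int L = 6 * int (L div 6) + int (L mod 6)"
    by presburger
  ultimately show "edge i (Suc L) \<notin> M" "left_need i + right_need i + int (L mod 6) \<le> 0"
    using petal_count[OF assms(1)] by linarith+
qed

text \<open>
  If a hub between two petals without surplus were matched into one of them or dominated from it,
  its need there would be \<open>3\<close>, \<open>2\<close> or \<open>1\<close>. Since the needs of such a petal sum to at most \<open>0\<close>, the opposite
  hub has need at most \<open>-3\<close>, \<open>-2\<close> or \<open>-1\<close>, hence distance at most \<open>-1\<close> (a contradiction), \<open>0\<close> or \<open>1\<close>. So the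
  hub next to it is as near to \<open>D\<close> as it would have to be if it dominated the hub in question.
\<close>

lemma hub_between_no_surplus:
  assumes i: "i \<in> {1..n}" and s: "surplus i = 0" "surplus (succ i) = 0"
  shows "hub_dist (succ i) \<in> {1, 2}"
    and "hub_dist (succ i) = 1 \<Longrightarrow> hub_dist i = 0 \<or> hub_dist (succ (succ i)) = 0"
    and "hub_dist (succ i) = 2 \<Longrightarrow> hub_dist i \<le> 1 \<or> hub_dist (succ (succ i)) \<le> 1"
proof -
  let ?u = "UVert (succ i)"
  note i' = succ_range[OF i]
  note left = no_surplus[OF i s(1)] and right = no_surplus[OF i' s(2)]
  note ge = left_need_ge[of i] right_need_ge[of i] left_need_ge[of "succ i"] right_need_ge[of "succ i"]
  have "?u \<notin> D"
  proof
    assume u: "?u \<in> D"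
    then obtain j r where jr: "j \<in> {1..n}" "r \<le> Suc L" "?u \<in> edge j r" "edge j r \<in> M"
      using matched by blast
    then have "edge (succ i) 0 \<in> M \<or> edge i L \<in> M"
      using edge_at_hub[OF i jr(1-3)] left right by auto
    then have "left_need (succ i) = 3 \<or> right_need i = 3"
      using u by (auto simp: edge_path left_need_def right_need_def need_def insert_commute)
    then show False
      using left right ge by linarith
  qed
  then show "hub_dist (succ i) \<in> {1, 2}"
    using hub_dist_eq_0[of "succ i"] hub_dist_le_2[of "succ i"] by force
  {
    assume "hub_dist (succ i) = 1"
    then have "?u \<in> near F D 1"
      using hub_dist_le_1 by (metis order_refl)
    then obtain w where w: "(?u, w) \<in> arcs_ends F" "w \<in> D"
      using \<open>?u \<notin> D\<close> unfolding near_1 by blast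
    from hub_nbr[OF w(1) i] consider "w = UVert i \<or> w = UVert (succ (succ i))"
      | "w = pos (succ i) 1" | "w = pos i L"
      by blast
    then show "hub_dist i = 0 \<or> hub_dist (succ (succ i)) = 0"
    proof cases
      case 1
      then show ?thesis
        using w(2) hub_dist_eq_0[of i] hub_dist_eq_0[of "succ (succ i)"] by metis
    next
      case 2
      then have "left_need (succ i) = 2"
        using w(2) \<open>?u \<notin> D\<close> by (simp add: left_need_def need_def)
      then show ?thesis using right ge by linarith
    next
      case 3
      then have "right_need i = 2"
        using w(2) \<open>?u \<notin> D\<close> by (simp add: right_need_def need_def)
      then show ?thesis using left ge by linarith
    qed
  }
  {
    assume "hub_dist (succ i) = 2"
    then have u1: "?u \<notin> near F D 1"
      using hub_dist_le_1[of "succ i"] by linarith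
    have "?u \<in> near F D (Suc 1)"
      using dominated pos_in_verts[OF i', of 0] pos_0 by (metis Suc_1 subsetD)
    then obtain w where w: "(?u, w) \<in> arcs_ends F" "w \<in> near F D 1"
      using u1 unfolding near.simps(2) by blast
    have wD: "w \<notin> D" using w(1) u1 unfolding near_1 by blast
    from hub_nbr[OF w(1) i] consider "w = UVert i \<or> w = UVert (succ (succ i))"
      | "w = pos (succ i) 1" | "w = pos i L"
      by blast
    then show "hub_dist i \<le> 1 \<or> hub_dist (succ (succ i)) \<le> 1"
    proof cases
      case 1
      then show ?thesis
        using w(2) hub_dist_le_1[of i] hub_dist_le_1[of "succ (succ i)"] by metis
    next
      case 2
      then obtain w' where w': "(pos (succ i) 1, w') \<in> arcs_ends F" "w' \<in> D"
        using w(2) wD unfolding near_1 by blast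
      have "w' = pos (succ i) 2"
        using inner_nbr[OF w'(1)] L_pos w'(2) \<open>?u \<notin> D\<close>
        by (metis Suc_1 diff_self_eq_0 order_refl pos_0)
      then have "left_need (succ i) = 1"
        using w'(2) u1 \<open>?u \<notin> D\<close> wD 2 by (simp add: left_need_def need_def)
      then show ?thesis using right ge by linarith
    next
      case 3
      then obtain w' where w': "(pos i L, w') \<in> arcs_ends F" "w' \<in> D"
        using w(2) wD unfolding near_1 by blast
      have "w' = pos i (L - 1)"
        using inner_nbr[OF w'(1)] L_pos w'(2) \<open>?u \<notin> D\<close>
        by (metis order_refl pos_Suc_L)
      then have "right_need i = 1"
        using w'(2) u1 \<open>?u \<notin> D\<close> wD 3 by (simp add: right_need_def need_def)
      then show ?thesis using left ge by linarith
    qed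
  }
qed

lemma surplus_window:
  assumes i: "i \<in> {1..n}"
  shows "\<exists>j < 6 - L mod 6. 0 < surplus ((succ ^^ j) i)"
proof (rule ccontr)
  define h where "h j = (succ ^^ j) i" for j
  have h: "h j \<in> {1..n}" "h (Suc j) = succ (h j)" for j
    unfolding h_def using i succ_range by (induction j) auto
  assume "\<not> ?thesis"
  then have zero: "surplus (h j) = 0" if "j < 6 - L mod 6" for j
    using that by (auto simp: h_def)
  show False
  proof (rule no_long_gap[of "6 - L mod 6" "\<lambda>j. hub_dist (h j)"])
    fix j assume "j < 6 - L mod 6"
    then show "hub_dist (h j) + hub_dist (h (Suc j)) + 2 \<le> 6 - L mod 6"
      using no_surplus(1)[OF h(1)[of j] zero] left_need_ge[of "h j"] right_need_ge[of "h j"]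
      by (simp add: h(2))
  next
    fix j assume "0 < j" "j < 6 - L mod 6"
    then obtain l where l: "j = Suc l" "surplus (h l) = 0" "surplus (succ (h l)) = 0"
      using zero[of "j - 1"] zero[of j] h(2)[of "j - 1"] by (cases j) auto
    note between = hub_between_no_surplus[OF h(1) l(2,3)]
    show "hub_dist (h j) \<in> {1, 2}"
      using between(1) by (simp add: l h(2))
    show "hub_dist (h j) = 1 \<Longrightarrow> hub_dist (h (j - 1)) = 0 \<or> hub_dist (h (Suc j)) = 0"
      using between(2) by (simp add: l h(2))
    show "hub_dist (h j) = 2 \<Longrightarrow> hub_dist (h (j - 1)) \<le> 1 \<or> hub_dist (h (Suc j)) \<le> 1"
      using between(3) by (simp add: l h(2))
  qed auto
qed

lemma card_M_ge: "n * (L div 6) + (\<Sum>i = 1..n. surplus i) \<le> card M"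
proof -
  define I where "I = (SIGMA i:{1..n}. {p. p \<le> Suc L \<and> edge i p \<in> M})"
  have "L div 6 + surplus i = card {p. p \<le> Suc L \<and> edge i p \<in> M}" if "i \<in> {1..n}" for i
  proof -
    have "{p. p \<le> Suc L \<and> edge i p \<in> M} =
        petal_edges i \<union> (if edge i (Suc L) \<in> M then {Suc L} else {})"
      by (auto simp: petal_edges_def le_Suc_eq)
    then have "card {p. p \<le> Suc L \<and> edge i p \<in> M} =
        card (petal_edges i) + (if edge i (Suc L) \<in> M then 1 else 0)"
      using finite_petal_edges[of i] by (auto simp: petal_edges_def)
    then show ?thesis
      using petal_edges_ge[OF that] by (simp add: surplus_def)
  qed
  then have "card I = (\<Sum>i = 1..n. L div 6 + surplus i)"
    unfolding I_def by simp
  then have "n * (L div 6) + (\<Sum>i = 1..n. surplus i) = card I"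
    by (simp add: sum.distrib)
  also have "card I = card ((\<lambda>(i, p). edge i p) ` I)"
    by (intro card_image[symmetric] inj_on_subset[OF edge_inj]) (auto simp: I_def)
  also have "\<dots> \<le> card M"
  proof (rule card_mono)
    show "finite M"
      using M_edges finite_subset unfolding edges_eq by fastforce
  qed (auto simp: I_def)
  finally show ?thesis .
qed

lemma card_D: "card D = 2 * card M"
proof -
  have "card e = 2" if "e \<in> M" for e
  proof -
    have "e \<in> edges F"
      using that M_edges by blast
    then obtain u v where uv: "(u, v) \<in> arcs_ends F" "e = {u, v}"
      unfolding edges_def by auto
    then have "u \<noteq> v"
      using no_loop by metis
    then show ?thesis
      using uv by simp
  qed
  moreover from this have "\<forall>e \<in> M. finite e"
    using card.infinite by fastforce
  ultimately have "card (\<Union>M) = (\<Sum>e\<in>M. 2)"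
    using M_disjoint by (subst card_Union_disjoint) (auto simp: disjoint_def pairwise_def disjnt_def)
  then show ?thesis
    using M_covers by simp
qed

lemma card_D_ge: "2 * (n * (L div 6) + nat \<lceil>real n / real (6 - L mod 6)\<rceil>) \<le> card D"
proof -
  have "n \<le> (6 - L mod 6) * (\<Sum>i = 1..n. surplus i)"
    using sum_ge_of_windows[OF _ succ_bij surplus_window] by simp
  then have "real n \<le> real (6 - L mod 6) * real (\<Sum>i = 1..n. surplus i)"
    by (metis of_nat_le_iff of_nat_mult)
  then have "real n / real (6 - L mod 6) \<le> real (\<Sum>i = 1..n. surplus i)"
    by (simp add: divide_simps mult.commute)
  then have "nat \<lceil>real n / real (6 - L mod 6)\<rceil> \<le> (\<Sum>i = 1..n. surplus i)"
    by (simp add: ceiling_le_iff nat_le_iff)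
  then have "n * (L div 6) + nat \<lceil>real n / real (6 - L mod 6)\<rceil> \<le> card M"
    using card_M_ge by (meson add_left_mono le_trans)
  then show ?thesis
    unfolding card_D by (rule mult_le_mono2)
qed

end

section \<open>An optimal paired dominating set\<close>

context flower
begin

definition period :: nat where
  "period = 6 - L mod 6"

definition offset :: "nat \<Rightarrow> nat" where
  "offset i = (i - 1) mod period"

text \<open>
  The distance from hub \<open>i\<close> to the nearest of the hubs at offsets \<open>0\<close> and \<open>1\<close>. For offsets above \<open>1\<close>, the
  candidates are the second hub of the own group, and the first hub of the next
  group; the last group ends at hub \<open>n\<close> even if it is shorter than the others.
\<close>

definition depth :: "nat \<Rightarrow> nat" where
  "depth i = (if offset i \<le> 1 then 0
     else min (offset i - 1) (min (period - offset i) (n + 1 - i)))"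

text \<open>
  The edge that matches the first hub of a group: to the second hub if the group has one, and else
  to the first inner vertex of its petal.
\<close>

definition head_label :: "nat \<Rightarrow> nat" where
  "head_label i = (if 2 \<le> period \<and> i < n then Suc L else 0)"

text \<open>
  The position of the first pair of a petal. Hub \<open>i\<close> dominates the positions up to \<open>2 - depth i\<close>,
  and the interval of a pair begins two positions before it, which gives \<open>5 - depth i\<close>. If \<open>period = 1\<close>,
  then every hub is matched with position \<open>1\<close>, and this pair dominates one position more.
\<close>

definition start :: "nat \<Rightarrow> nat" where
  "start i = 5 - depth i + (if period = 1 then 1 else 0)"

definition heads :: "nat set" where
  "heads = {i \<in> {1..n}. offset i = 0}"

definition head_labels :: "(nat \<times> nat) set" where
  "head_labels = (\<lambda>i. (i, head_label i)) ` heads"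

definition petal_labels :: "(nat \<times> nat) set" where
  "petal_labels = (\<lambda>(i, a). (i, start i + 6 * a)) ` ({1..n} \<times> {..<L div 6})"

definition matching :: "flower_vertex set set" where
  "matching = (\<lambda>(i, p). edge i p) ` (head_labels \<union> petal_labels)"

lemma period_bounds: "1 \<le> period" "period \<le> 6"
  and L_eq: "L + period = 6 * (L div 6) + 6"
  unfolding period_def by presburger+

lemma offset_less: "offset i < period"
  using period_bounds by (simp add: offset_def)

lemma offset_Suc: "1 \<le> i \<Longrightarrow> offset (Suc i) = (if Suc (offset i) = period then 0 else Suc (offset i))"
  using mod_Suc[of "i - 1" period] by (simp add: offset_def)

lemma offset_1: "offset 1 = 0"
  by (simp add: offset_def)

lemma offset_le: "offset i \<le> i - 1"
  by (simp add: offset_def)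

lemma succ_eq: "i < n \<Longrightarrow> succ i = Suc i" and succ_n: "succ n = 1"
  by (simp_all add: next_index_def)

lemma depth_le_2: "depth i \<le> 2"
  using period_bounds unfolding depth_def by (auto simp: min_def)

text \<open>
  Between the extra pairs of two consecutive groups, \<open>depth\<close> is bounded by the distances to both.
  At offset \<open>a\<close> these are at most \<open>a - 1\<close> and \<open>period - a\<close>; for two consecutive hubs, the first
  bound for the former and the second bound for the latter add up to \<open>period - 2\<close>.
\<close>

lemma depth_sum:
  assumes "i \<in> {1..n}" "2 \<le> period"
  shows "depth i + depth (succ i) + 2 \<le> period"
proof (cases "i = n")
  case True
  then show ?thesis
    using assms offset_1 offset_less[of i] by (auto simp: succ_n depth_def min_def)
next
  case False
  then show ?thesis
    using assms offset_Suc[of i] offset_less[of i] by (auto simp: succ_eq depth_def min_def)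
qed

lemma depth_nbr:
  assumes i: "i \<in> {1..n}" and d: "0 < depth i"
  shows "\<exists>j \<in> {1..n}. Suc (depth j) = depth i \<and> (j = succ i \<or> i = succ j)"
proof -
  define e where "e = min (period - offset i) (n + 1 - i)"
  have a: "2 \<le> offset i" and depth: "depth i = min (offset i - 1) e"
    using d by (auto simp: depth_def e_def split: if_splits)
  have "1 \<le> e"
    using offset_less[of i] i by (auto simp: e_def)
  consider "offset i - 1 \<le> e" | "e = 1" "e < offset i - 1" | "2 \<le> e" "e < offset i - 1"
    using \<open>1 \<le> e\<close> by linarith
  then show ?thesis
  proof cases
    case 1
    define j where "j = i - 1"
    have j: "i = Suc j" "1 \<le> j" "j < n"
      using offset_le[of i] a i by (auto simp: j_def)
    have "Suc (offset j) = offset i"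
      using offset_Suc[OF j(2)] a j(1) by (auto split: if_splits)
    then have "Suc (depth j) = depth i"
      using 1 a depth j by (auto simp: depth_def e_def min_def split: if_splits)
    then show ?thesis
      using j by (intro bexI[of _ j]) (auto simp: succ_eq)
  next
    case 2
    have "offset (succ i) = 0"
    proof (cases "i = n")
      case True
      then show ?thesis by (simp only: succ_n offset_1)
    next
      case False
      then have "Suc (offset i) = period"
        using 2 i offset_less[of i] by (auto simp: e_def min_def split: if_splits)
      then show ?thesis
        using False i offset_Suc[of i] by (simp add: succ_eq)
    qed
    then have "depth (succ i) = 0"
      by (simp add: depth_def)
    then show ?thesis
      using 2 depth succ_range[OF i] by (intro bexI[of _ "succ i"]) auto
  next
    case 3
    then have "i < n" "Suc (offset i) < period"
      using i by (auto simp: e_def)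
    moreover from this have "offset (Suc i) = Suc (offset i)"
      using i by (simp add: offset_Suc)
    moreover from this have "min (period - offset (Suc i)) (n + 1 - Suc i) = e - 1"
      unfolding e_def by (auto simp: min_def)
    ultimately have "Suc (depth (Suc i)) = depth i"
      using 3 a depth by (auto simp: depth_def min_def)
    then show ?thesis
      using \<open>i < n\<close> i by (intro bexI[of _ "Suc i"]) (auto simp: succ_eq)
  qed
qed

text \<open>The pairs of a petal avoid both hubs and also the first inner vertex, which may be matched to a hub.\<close>

lemma petal_label_bounds:
  assumes "a < L div 6"
  shows "3 \<le> start i + 6 * a" "Suc (start i + 6 * a) \<le> L"
  using assms depth_le_2[of i] L_eq period_bounds unfolding start_def by (auto split: if_splits)

lemma petal_label_edge:
  assumes "a < L div 6"
  shows "edge i (start i + 6 * a) = {VVert i (start i + 6 * a), VVert i (Suc (start i + 6 * a))}"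
  using petal_label_bounds[OF assms, of i] by (simp add: edge_path pos_inner)

lemma head_label_edge:
  "edge i (head_label i) =
    {UVert i, if 2 \<le> period \<and> i < n then UVert (Suc i) else VVert i 1}"
  using L_pos by (auto simp: head_label_def edge_hub succ_eq edge_path pos_inner)

lemma finite_heads: "finite heads"
  by (simp add: heads_def)

lemma head_labels_disjoint:
  assumes "i \<in> heads" "j \<in> heads" "v \<in> edge i (head_label i)" "v \<in> edge j (head_label j)"
  shows "i = j"
proof -
  have "offset (Suc l) = 1" if "l \<in> heads" "2 \<le> period" for l
    using that offset_Suc[of l] by (auto simp: heads_def)
  then have "Suc l \<notin> heads" if "l \<in> heads" "2 \<le> period" for l
    using that by (auto simp: heads_def)
  then show ?thesis
    using assms unfolding head_label_edge by (auto split: if_splits)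
qed

lemma matching_disjoint: "disjoint matching"
proof -
  have "(i, p) = (j, r)"
    if ip: "(i, p) \<in> head_labels \<union> petal_labels" and jr: "(j, r) \<in> head_labels \<union> petal_labels"
      and v: "v \<in> edge i p" "v \<in> edge j r" for i p j r v
  proof -
    have mixed: False
      if "v \<in> edge i (head_label i)" "v \<in> edge j (start j + 6 * a)" "a < L div 6" for i j a
      using that(1,2) petal_label_bounds(1)[OF that(3), of j]
      unfolding head_label_edge petal_label_edge[OF that(3)] by (auto split: if_splits)
    consider "p = head_label i" "r = head_label j" "i \<in> heads" "j \<in> heads"
      | a where "p = head_label i" "r = start j + 6 * a" "a < L div 6"
      | a where "p = start i + 6 * a" "r = head_label j" "a < L div 6"
      | a b where "p = start i + 6 * a" "r = start j + 6 * b" "a < L div 6" "b < L div 6"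
      using ip jr by (auto simp: head_labels_def petal_labels_def)
    then show ?thesis
    proof cases
      case 1
      then show ?thesis using head_labels_disjoint v by blast
    next
      case 4
      then show ?thesis
        using v petal_label_edge[OF 4(3), of i] petal_label_edge[OF 4(4), of j] by (auto, presburger+)
    qed (use mixed v in blast)+
  qed
  then show ?thesis
    unfolding matching_def disjoint_def by (clarsimp simp: disjoint_iff) blast
qed

definition dominators :: "flower_vertex set" where
  "dominators = \<Union>matching"

lemma labels_range: "head_labels \<union> petal_labels \<subseteq> {1..n} \<times> {..Suc L}"
proof -
  have "start i + 6 * a \<le> Suc L" if "a < L div 6" for i a
    using petal_label_bounds(2)[OF that, of i] by linarith
  then show ?thesis
    by (auto simp: head_labels_def petal_labels_def heads_def head_label_def)
qed

lemma matching_edges: "matching \<subseteq> edges F"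
  unfolding matching_def edges_eq using labels_range by (rule image_mono)

lemma dominators_verts: "dominators \<subseteq> verts F"
proof
  fix v assume "v \<in> dominators"
  then obtain i p where "(i, p) \<in> head_labels \<union> petal_labels" and v: "v \<in> edge i p"
    by (auto simp: dominators_def matching_def)
  then have "i \<in> {1..n}"
    using labels_range by blast
  then show "v \<in> verts F"
    using v pos_in_verts[of i] by (auto simp only: edge_def insert_iff empty_iff)
qed

lemma perfect_matching_dominators: "perfect_matching (F \<restriction> dominators) matching"
  using matching_edges matching_disjoint
  by (auto simp: perfect_matching_def edges_induce_subgraph dominators_def)

lemma head_edge_in_dominators: "i \<in> heads \<Longrightarrow> edge i (head_label i) \<subseteq> dominators"
  by (auto simp: dominators_def matching_def head_labels_def)

lemma petal_edge_in_dominators: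
  assumes "i \<in> {1..n}" "a < L div 6"
  shows "pos i (start i + 6 * a) \<in> dominators" "pos i (Suc (start i + 6 * a)) \<in> dominators"
proof -
  have "(i, start i + 6 * a) \<in> petal_labels"
    using assms by (auto simp: petal_labels_def)
  then have "edge i (start i + 6 * a) \<subseteq> dominators"
    by (force simp: dominators_def matching_def)
  moreover have "start i + 6 * a \<le> L"
    using petal_label_bounds(2)[OF assms(2), of i] by linarith
  ultimately show "pos i (start i + 6 * a) \<in> dominators" "pos i (Suc (start i + 6 * a)) \<in> dominators"
    by (simp_all add: edge_path)
qed

lemma hub_near_dominators:
  assumes "i \<in> {1..n}"
  shows "UVert i \<in> near F dominators (depth i)"
  using assms
proof (induction "depth i" arbitrary: i)
  case 0
  have "offset i \<le> 1"
    using 0 offset_less[of i] by (auto simp: depth_def min_def split: if_splits)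
  then consider "offset i = 0" | "offset i = 1" by linarith
  then have "UVert i \<in> dominators"
  proof cases
    case 1
    then show ?thesis
      using 0 head_edge_in_dominators[of i] by (simp add: heads_def head_label_edge)
  next
    case 2
    define j where "j = i - 1"
    have j: "i = Suc j" "1 \<le> j" "j < n"
      using offset_le[of i] 2 0 by (auto simp: j_def)
    then have "offset j = 0" "2 \<le> period"
      using offset_Suc[OF j(2)] 2 offset_less[of i] by (auto split: if_splits)
    then show ?thesis
      using j head_edge_in_dominators[of j] by (simp add: heads_def head_label_edge)
  qed
  then show ?case using 0 by simp
next
  case (Suc d)
  then obtain j where j: "j \<in> {1..n}" "Suc (depth j) = depth i" "j = succ i \<or> i = succ j"
    using depth_nbr[of i] by auto
  then have "d = depth j"
    using Suc.hyps(2) by simp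
  then have "UVert j \<in> near F dominators d"
    using Suc.hyps(1)[of j] j(1) by simp
  moreover have "(UVert i, UVert j) \<in> arcs_ends F"
    using j hub_arc arc_sym Suc.prems by blast
  ultimately show ?case
    unfolding Suc.hyps(2)[symmetric] by (rule near_step)
qed

text \<open>
  One of the two truncated differences is \<open>0\<close>, so their sum is the distance between the
  positions \<open>p\<close> and \<open>r\<close>.
\<close>

lemma near_along_petal:
  assumes "i \<in> {1..n}" "pos i p \<in> near F A t" "p \<le> Suc L" "r \<le> Suc L"
  shows "pos i r \<in> near F A (t + (p - r) + (r - p))"
proof (cases "p \<le> r")
  case True
  then have "pos i r \<in> near F A (t + (r - p))"
    using assms(4)
  proof (induction rule: dec_induct)
    case base
    then show ?case using assms by simp
  next
    case (step r)
    then show ?case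
      using near_step[OF _ arc_sym[OF path_arc[OF assms(1)]], of r A "t + (r - p)"]
      by (simp add: Suc_diff_le)
  qed
  then show ?thesis using True by simp
next
  case False
  then have "r \<le> p" by simp
  then have "pos i r \<in> near F A (t + (p - r))"
  proof (induction rule: inc_induct)
    case base
    then show ?case using assms by simp
  next
    case (step r)
    then have "p - r = Suc (p - Suc r)" "r \<le> L" using assms(3) by linarith+
    then show ?case
      using near_step[OF step.IH path_arc[OF assms(1)]] by simp
  qed
  then show ?thesis using False by simp
qed

text \<open>
  The intervals of the \<open>q\<close> pairs are adjacent and cover \<open>6 q\<close> positions from \<open>start i - 2\<close> on. The positions
  before them are dominated through hub \<open>i\<close>; those after them through the next hub, because
  \<open>depth_sum\<close> leaves at most \<open>2 - depth (succ i)\<close> of them. If \<open>period = 1\<close>, all hubs belong to the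
  set; the pair of hub \<open>i\<close> dominates three positions, and two positions remain for the next hub.
\<close>

lemma petal_near_dominators:
  assumes i: "i \<in> {1..n}" and p: "1 \<le> p" "p \<le> L"
  shows "pos i p \<in> near F dominators 2"
proof -
  have close: "pos i p \<in> near F dominators 2"
    if "pos i r \<in> near F dominators t" "r \<le> Suc L" "t + (r - p) + (p - r) \<le> 2" for r t
    using near_along_petal[OF i that(1,2), of p] near_mono[OF that(3)] p by fastforce
  consider "p + depth i \<le> 2" | "Suc L + depth (succ i) \<le> p + 2" | "period = 1" "p \<le> 3"
    | "start i \<le> p + 2" "p + 3 \<le> start i + 6 * (L div 6)"
  proof (cases "period = 1")
    case True
    then have "depth (succ i) = 0" "start i = 6"
      using offset_less[of i] offset_less[of "succ i"] by (auto simp: depth_def start_def)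
    then show thesis
      using that True L_eq by linarith
  next
    case False
    then have "depth i + depth (succ i) + 2 \<le> period" "start i = 5 - depth i"
      using depth_sum[OF i] period_bounds by (auto simp: start_def)
    then show thesis
      using that L_eq depth_le_2[of i] by linarith
  qed
  then show ?thesis
  proof cases
    case 1
    then show ?thesis
      using close[of 0 "depth i"] hub_near_dominators[OF i] by simp
  next
    case 2
    then show ?thesis
      using close[of "Suc L" "depth (succ i)"] hub_near_dominators[OF succ_range[OF i]] p by simp
  next
    case 3
    then have "i \<in> heads" "VVert i 1 \<in> edge i (head_label i)"
      using i offset_less[of i] by (auto simp: heads_def head_label_edge)
    then have "pos i 1 \<in> near F dominators 0"
      using head_edge_in_dominators[of i] L_pos by (auto simp: pos_inner)
    then show ?thesis
      using close[of 1 0] 3 L_pos p by simp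
  next
    case 4
    \<comment> \<open>The index of the pair whose interval contains \<open>p\<close>.\<close>
    define a where "a = (p + 2 - start i) div 6"
    have a: "a < L div 6" "start i + 6 * a \<le> p + 2" "p \<le> start i + 6 * a + 3"
      using 4 unfolding a_def by linarith+
    note in_D = petal_edge_in_dominators[OF i a(1)] and bounds = petal_label_bounds[OF a(1), of i]
    show ?thesis
    proof (cases "p \<le> start i + 6 * a")
      case True
      then show ?thesis
        using close[of "start i + 6 * a" 0] in_D(1) a bounds by simp
    next
      case False
      then show ?thesis
        using close[of "Suc (start i + 6 * a)" 0] in_D(2) a bounds by simp
    qed
  qed
qed

lemma dominating_dominators: "distance_paired_dominating 2 F dominators"
proof -
  have "v \<in> near F dominators 2" if "v \<in> verts F" for v
  proof -
    from that obtain i p where v: "i \<in> {1..n}" "p \<le> L" "v = pos i p"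
      by (rule verts_cases)
    show ?thesis
    proof (cases "p = 0")
      case True
      then show ?thesis
        using hub_near_dominators[OF v(1)] near_mono[OF depth_le_2] v by fastforce
    next
      case False
      then show ?thesis
        using petal_near_dominators[OF v(1)] v by simp
    qed
  qed
  then show ?thesis
    unfolding distance_paired_dominating_iff_near[OF wf_F]
    using dominators_verts perfect_matching_dominators by blast
qed

lemma card_heads: "card heads \<le> nat \<lceil>real n / real period\<rceil>"
proof -
  have "heads \<subseteq> (\<lambda>j. Suc (period * j)) ` {..<nat \<lceil>real n / real period\<rceil>}"
  proof
    fix i assume "i \<in> heads"
    then have i: "1 \<le> i" "i \<le> n" "(i - 1) mod period = 0"
      by (auto simp: heads_def offset_def)
    define j where "j = (i - 1) div period"
    have j: "i = Suc (period * j)"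
      using i by (auto simp: j_def)
    then have "real period * real j < real n"
      using i by (metis Suc_le_lessD of_nat_less_iff of_nat_mult)
    then have "real j < real n / real period"
      using period_bounds by (simp add: field_simps)
    then have "j < nat \<lceil>real n / real period\<rceil>"
      by (simp add: less_ceiling_iff zless_nat_eq_int_zless)
    then show "i \<in> (\<lambda>j. Suc (period * j)) ` {..<nat \<lceil>real n / real period\<rceil>}"
      using j by blast
  qed
  then show ?thesis
    using surj_card_le[OF finite_lessThan] by (metis card_lessThan)
qed

lemma card_dominators: "card dominators \<le> 2 * (n * (L div 6) + nat \<lceil>real n / real period\<rceil>)"
proof -
  have "card dominators \<le> (\<Sum>e\<in>matching. card e)"
    unfolding dominators_def by (rule card_Union_le_sum_card)
  also have "\<dots> \<le> (\<Sum>e\<in>matching. 2)"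
    by (intro sum_mono) (auto simp: matching_def edge_def card_insert_if)
  also have "\<dots> = 2 * card matching"
    by simp
  also have "card matching \<le> card (head_labels \<union> petal_labels)"
    unfolding matching_def
    by (intro card_image_le) (auto simp: head_labels_def petal_labels_def finite_heads)
  also have "\<dots> \<le> card head_labels + card petal_labels"
    by (rule card_Un_le)
  also have "card head_labels \<le> card heads"
    unfolding head_labels_def by (intro card_image_le finite_heads)
  also have "card petal_labels \<le> card ({1..n} \<times> {..<L div 6})"
    unfolding petal_labels_def by (intro card_image_le) auto
  finally show ?thesis
    using card_heads by (simp add: card_cartesian_product)
qed

section \<open>The paired domination number\<close>

lemma paired_domination_number_eq:
  "distance_paired_domination_number 2 F = 2 * (n * (L div 6) + nat \<lceil>real n / real (6 - L mod 6)\<rceil>)"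
  (is "_ = ?N")
proof -
  have lower: "?N \<le> card D" if "distance_paired_dominating 2 F D" for D
  proof -
    from that obtain M where "verts F \<subseteq> near F D 2" "perfect_matching (F \<restriction> D) M"
      unfolding distance_paired_dominating_iff_near[OF wf_F] by blast
    then interpret paired_dominated_flower n m D M
      by unfold_locales (auto simp: perfect_matching_def edges_induce_subgraph)
    show ?thesis by (rule card_D_ge)
  qed
  have "card dominators = ?N"
    using lower[OF dominating_dominators] card_dominators by (simp add: period_def)
  then show ?thesis
    unfolding distance_paired_domination_number_def
    using lower dominating_dominators by (intro Least_equality) blast+
qed

end

theorem theorem3p1:
  fixes n m :: nat
  assumes "m \<ge> 3" and "n \<ge> 3"
  shows
    "(m mod 6 \<in> {0, 5} \<longrightarrow>
        int (distance_paired_domination_number 2 (flower_graph n m)) =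
          2 * \<lceil>(real n * real m - 3 * real n) / 6\<rceil>) \<and>
     (m mod 6 \<in> {1, 2} \<longrightarrow>
        int (distance_paired_domination_number 2 (flower_graph n m)) =
          2 * \<lceil>(real n * real m - real n) / 6\<rceil>) \<and>
     (m mod 6 = 3 \<longrightarrow>
        int (distance_paired_domination_number 2 (flower_graph n m)) =
          2 * \<lceil>(5 * real n * real m - 9 * real n) / 30\<rceil>) \<and>
     (m mod 6 = 4 \<longrightarrow>
        int (distance_paired_domination_number 2 (flower_graph n m)) =
          2 * \<lceil>(2 * real n * real m - 5 * real n) / 12\<rceil>)"
proof -
  interpret flower n m
    using assms by unfold_locales
  define q s where "q = (m - 2) div 6" and "s = (m - 2) mod 6"
  have m: "m = 6 * q + s + 2" and "s < 6"
    using assms by (auto simp: q_def s_def)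
  \<comment> \<open>The integer \<open>n q\<close> moves into the ceiling; what remains is arithmetic in each residue class.\<close>
  have gamma: "int (distance_paired_domination_number 2 (flower_graph n m)) = 2 * \<lceil>x\<rceil>"
    if "x = real n * real q + real n / real (6 - s)" for x
  proof -
    have "\<lceil>x\<rceil> = int (n * q) + \<lceil>real n / real (6 - s)\<rceil>"
      unfolding that by (metis ceiling_add_of_int add.commute of_int_of_nat_eq of_nat_mult)
    moreover have "0 \<le> \<lceil>real n / real (6 - s)\<rceil>"
      by (simp add: order_less_le_trans[of _ 0])
    ultimately show ?thesis
      unfolding paired_domination_number_eq by (simp add: L_def q_def s_def)
  qed
  have residue: "m mod 6 = (s + 2) mod 6"
    unfolding m by presburger
  have real_m: "real m = 6 * real q + real s + 2"
    unfolding m by simp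
  consider "s = 0" | "s = 1" | "s = 2" | "s = 3" | "s = 4" | "s = 5"
    using \<open>s < 6\<close> by linarith
  then show ?thesis
  proof cases
    case 1
    have "int (distance_paired_domination_number 2 (flower_graph n m)) = 2 * \<lceil>(real n * real m - real n) / 6\<rceil>"
      by (rule gamma) (simp add: 1 real_m field_simps)
    then show ?thesis using residue 1 by simp
  next
    case 2
    have "int (distance_paired_domination_number 2 (flower_graph n m)) = 2 * \<lceil>(5 * real n * real m - 9 * real n) / 30\<rceil>"
      by (rule gamma) (simp add: 2 real_m field_simps)
    then show ?thesis using residue 2 by simp
  next
    case 3
    have "int (distance_paired_domination_number 2 (flower_graph n m)) = 2 * \<lceil>(2 * real n * real m - 5 * real n) / 12\<rceil>"
      by (rule gamma) (simp add: 3 real_m field_simps)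
    then show ?thesis using residue 3 by simp
  next
    case 4
    have "int (distance_paired_domination_number 2 (flower_graph n m)) = 2 * \<lceil>(real n * real m - 3 * real n) / 6\<rceil>"
      by (rule gamma) (simp add: 4 real_m field_simps)
    then show ?thesis using residue 4 by simp
  next
    case 5
    have "int (distance_paired_domination_number 2 (flower_graph n m)) = 2 * \<lceil>(real n * real m - 3 * real n) / 6\<rceil>"
      by (rule gamma) (simp add: 5 real_m field_simps)
    then show ?thesis using residue 5 by simp
  next
    case 6
    have "int (distance_paired_domination_number 2 (flower_graph n m)) = 2 * \<lceil>(real n * real m - real n) / 6\<rceil>"
      by (rule gamma) (simp add: 6 real_m field_simps)
    then show ?thesis using residue 6 by simp
  qed
qed

end
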